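(* Let $X$ be a normed space, let $\mathcal{C}\subset X$ be a co-radiant subset with $d_{\mathcal{C}}>0$, let $A\subset X$, $\varepsilon>0$, and $\lambda>0$. The following statements hold. (i) If $(f,\alpha)\in\mathcal{C}^{a\#}_{\lambda}(\varepsilon)$, then $AE(A,\mathcal{K}_{f,\alpha},\lambda)\subseteq AE(A,\mathcal{C},\varepsilon)$. (ii) If $(f,\alpha)\in\mathcal{C}^{a*}_{\lambda}(\varepsilon)$ and $x_0\in AE(A,\mathcal{K}_{f,\alpha},\lambda)$, then $$\left[x_0+\{x\in X: p_{f,\alpha}(x)<0\}\right]\cap A\ \subset\ AE(A,\mathcal{C},\varepsilon).$$
   Context: $X$ is a real normed space with dual $X^*$ and dual norm $\|\cdot\|_*$. A co-radiant set is a set $\mathcal{C}\subset X$ with $\mathcal{C}\ne\emptyset$, $\mathcal{C}\neq X$ (proper) and $\lambda x\in\mathcal{C}$ for all $\lambda\ge1$, $x\in\mathcal{C}$. For $\varepsilon>0$, $\mathcal{C}(\varepsilon):=\varepsilon\,\mathcal{C}$, and $d_{\mathcal{C}}:=\inf\{\|c\|:c\in\mathcal{C}\}$. A set $S$ is pointed if $S\cap(-S)\subset\{0_X\}$. $\mathcal{C}^{\#}:=\{f\in X^*: f(y)>0\ \forall y\in\mathcal{C}\}$. With $\mathbb{R}_+=(0,+\infty)$ and $\varepsilon,\lambda>0$: $$\mathcal{C}^{a*}_{\lambda}(\varepsilon):=\{(f,\alpha)\in\mathcal{C}^{\#}\times\mathbb{R}_+: f(y)-\alpha\|y\|\ge\lambda\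 \forall y\in\mathcal{C}(\varepsilon)\},$$ $$\mathcal{C}^{a\#}_{\lambda}(\varepsilon):=\{(f,\alpha)\in\mathcal{C}^{\#}\times\mathbb{R}_+: f(y)-\alpha\|y\|>\lambda\ \forall y\in\mathcal{C}(\varepsilon)\}.$$ For a proper pointed co-radiant set $\mathcal{C}$, $A\subset X$ and $\varepsilon>0$, a point $x_0\in A$ is an $\varepsilon$-efficient point with respect to $\mathcal{C}$, written $x_0\in AE(A,\mathcal{C},\varepsilon)$, if $(A-x_0)\cap(-\mathcal{C}(\varepsilon))\subset\{0_X\}$. (If one of the two augmented sets above is nonempty then $\mathcal{C}^{\#}\ne\emptyset$, so $\mathcal{C}$ is pointed.) For $f\in X^*$ and $0<\alpha<\|f\|_*$: $\mathcal{K}_{f,\alpha}:=\{x\in X: f(x)-\alpha\|x\|>1\}$ (a proper pointed co-radiant set); membership of $(f,\alpha)$ in one of the two augmented sets above forces $\alpha<\|f\|_*$. For $f\in X^*$, $\alpha>0$: $p_{f,\alpha}(x):=f(x)+\alpha\|x\|$ for $x\in X$. *)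

theory Defs
  imports "HOL-Analysis.Analysis"
begin

text \<open>The dual of the normed space \<open>'a\<close> is the type \<open>'a \<Rightarrow>\<^sub>L real\<close> of bounded linear functionals;
  its norm is the operator norm, i.e. the dual norm.\<close>

definition co_radiant :: "'a::real_normed_vector set \<Rightarrow> bool" where
  "co_radiant C \<longleftrightarrow> C \<noteq> {} \<and> C \<noteq> UNIV \<and> (\<forall>x\<in>C. \<forall>t\<ge>1. t *\<^sub>R x \<in> C)"

definition pointed :: "'a::real_normed_vector set \<Rightarrow> bool" where
  "pointed S \<longleftrightarrow> S \<inter> uminus ` S \<subseteq> {0}"

definition dilate :: "'a::real_normed_vector set \<Rightarrow> real \<Rightarrow> 'a set" where
  "dilate C \<epsilon> = (\<lambda>c. \<epsilon> *\<^sub>R c) ` C"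

definition dist_origin :: "'a::real_normed_vector set \<Rightarrow> real" where
  "dist_origin C = Inf {norm c | c. c \<in> C}"

definition dual_sharp :: "'a::real_normed_vector set \<Rightarrow> ('a \<Rightarrow>\<^sub>L real) set" where
  "dual_sharp C = {f. \<forall>y\<in>C. blinfun_apply f y > 0}"

definition aug_dual_star ::
    "'a::real_normed_vector set \<Rightarrow> real \<Rightarrow> real \<Rightarrow> (('a \<Rightarrow>\<^sub>L real) \<times> real) set" where
  "aug_dual_star C lam \<epsilon> =
     {(f, \<alpha>) \<in> dual_sharp C \<times> {0<..}. \<forall>y\<in>dilate C \<epsilon>. blinfun_apply f y - \<alpha> * norm y \<ge> lam}"

definition aug_dual_sharp ::
    "'a::real_normed_vector set \<Rightarrow> real \<Rightarrow> real \<Rightarrow> (('a \<Rightarrow>\<^sub>L real) \<times> real) set" where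
  "aug_dual_sharp C lam \<epsilon> =
     {(f, \<alpha>) \<in> dual_sharp C \<times> {0<..}. \<forall>y\<in>dilate C \<epsilon>. blinfun_apply f y - \<alpha> * norm y > lam}"

text \<open>Efficiency is meant for proper pointed co-radiant \<open>C\<close>. The definition is total; the lemmas
  at the end show that every use with a member of an augmented dual set is within this domain.\<close>

definition Eff :: "'a::real_normed_vector set \<Rightarrow> 'a set \<Rightarrow> real \<Rightarrow> 'a set" where
  "Eff A C \<epsilon> = {x0 \<in> A. (\<lambda>a. a - x0) ` A \<inter> uminus ` dilate C \<epsilon> \<subseteq> {0}}"

definition K_set :: "('a::real_normed_vector \<Rightarrow>\<^sub>L real) \<Rightarrow> real \<Rightarrow> 'a set" where
  "K_set f \<alpha> = {x. blinfun_apply f x - \<alpha> * norm x > 1}"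

definition p_fun :: "('a::real_normed_vector \<Rightarrow>\<^sub>L real) \<Rightarrow> real \<Rightarrow> 'a \<Rightarrow> real" where
  "p_fun f \<alpha> x = blinfun_apply f x + \<alpha> * norm x"

lemma pointed_of_dual_sharp:
  assumes "f \<in> dual_sharp C"
  shows "pointed C"
proof -
  have False if "y \<in> C" "- y \<in> C" for y
  proof -
    have "blinfun_apply f y > 0" "blinfun_apply f (- y) > 0"
      using assms that by (auto simp: dual_sharp_def)
    then show False by (simp add: blinfun.minus_right)
  qed
  then show ?thesis by (auto simp: pointed_def)
qed

lemma aug_dual_sharp_subset_star: "aug_dual_sharp C lam \<epsilon> \<subseteq> aug_dual_star C lam \<epsilon>"
  by (force simp: aug_dual_sharp_def aug_dual_star_def)

lemma aug_dual_star_less_norm: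
  assumes "co_radiant C" "lam > 0" "(f, \<alpha>) \<in> aug_dual_star C lam \<epsilon>"
  shows "0 < \<alpha>" "\<alpha> < norm f"
proof -
  show "0 < \<alpha>" using assms(3) by (simp add: aug_dual_star_def)
  obtain c where "c \<in> C" using assms(1) by (auto simp: co_radiant_def)
  define y where "y = \<epsilon> *\<^sub>R c"
  have "y \<in> dilate C \<epsilon>" using \<open>c \<in> C\<close> by (auto simp: y_def dilate_def)
  then have gt: "\<alpha> * norm y < blinfun_apply f y"
    using assms(2,3) by (force simp: aug_dual_star_def)
  also have "\<dots> \<le> norm f * norm y"
    using norm_blinfun[of f y] by simp
  finally show "\<alpha> < norm f"
    by (simp add: mult_less_cancel_right)
qed

lemma K_set_co_radiant_pointed:
  assumes "0 < \<alpha>" "\<alpha> < norm f"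
  shows "co_radiant (K_set f \<alpha>)" "pointed (K_set f \<alpha>)"
proof -
  obtain x where x: "\<alpha> * norm x < norm (blinfun_apply f x)"
    using assms norm_blinfun_bound[of \<alpha> f] by (meson less_imp_le not_le)
  obtain u where u: "blinfun_apply f u - \<alpha> * norm u > 0"
  proof (cases "blinfun_apply f x \<ge> 0")
    case True
    with x that[of x] show ?thesis by simp
  next
    case False
    with x that[of "- x"] show ?thesis by (simp add: blinfun.minus_right)
  qed
  define s where "s = 2 / (blinfun_apply f u - \<alpha> * norm u)"
  have "s > 0" using u by (simp add: s_def)
  have "s * (blinfun_apply f u - \<alpha> * norm u) = 2" using u unfolding s_def by (intro nonzero_eq_divide_eq[THEN iffD1]) auto
  then have "blinfun_apply f (s *\<^sub>R u) - \<alpha> * norm (s *\<^sub>R u) = 2"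
    using \<open>s > 0\<close> by (simp add: blinfun.scaleR_right algebra_simps)
  then have "s *\<^sub>R u \<in> K_set f \<alpha>" by (simp add: K_set_def)
  moreover have "0 \<notin> K_set f \<alpha>" by (simp add: K_set_def)
  moreover have "t *\<^sub>R y \<in> K_set f \<alpha>" if "y \<in> K_set f \<alpha>" "t \<ge> 1" for t y
  proof -
    have g: "blinfun_apply f y - \<alpha> * norm y > 1" using that(1) by (simp add: K_set_def)
    then have "1 * (blinfun_apply f y - \<alpha> * norm y) \<le> t * (blinfun_apply f y - \<alpha> * norm y)"
      using that(2) by (intro mult_right_mono) auto
    with g that(2) show ?thesis by (simp add: K_set_def blinfun.scaleR_right algebra_simps)
  qed
  ultimately show "co_radiant (K_set f \<alpha>)" by (auto simp: co_radiant_def)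
  have "f \<in> dual_sharp (K_set f \<alpha>)"
  proof -
    have "blinfun_apply f y > 0" if "blinfun_apply f y - \<alpha> * norm y > 1" for y
    proof -
      have "0 \<le> \<alpha> * norm y" using assms(1) by simp
      with that show ?thesis by linarith
    qed
    then show ?thesis by (auto simp: dual_sharp_def K_set_def)
  qed
  then show "pointed (K_set f \<alpha>)" by (rule pointed_of_dual_sharp)
qed

end

theory Submission
  imports Defs
begin

text \<open>Efficiency of x means that no a in A other than x has x - a in the dilated set. Put g(y)
  = f(y) - \<alpha> * norm y. Membership in \<open>aug_dual_sharp\<close> places
  \<open>dilate C \<epsilon>\<close> inside the region g > lam, which is the dilate of
  \<open>K_set f \<alpha>\<close> by lam (\<open>dilate_K_set\<close>). Shrinking the forbidden set
  keeps efficient points efficient (\<open>Eff_antimono\<close>), which gives the first claim.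
  Membership in \<open>aug_dual_star\<close> yields only g >= lam, and the missing strictness comes
  from p(u) < 0, where p is \<open>p_fun f \<alpha>\<close>. If x = x0 + u and y = x - a is in
  \<open>dilate C \<epsilon>\<close>, then x0 - a = y - u, and the triangle inequality gives g(y -
  u) >= g(y) - p(u) > lam, contradicting the efficiency of x0
  (\<open>mem_Eff_K_set_iff\<close>).\<close>

text \<open>Positive homogeneity of f - \<alpha> * norm moves the threshold from 1 to lam.\<close>

lemma dilate_K_set:
  assumes "lam > 0"
  shows "dilate (K_set f \<alpha>) lam = {x. blinfun_apply f x - \<alpha> * norm x > lam}"
proof (intro equalityI subsetI)
  fix x
  assume "x \<in> dilate (K_set f \<alpha>) lam"
  then obtain c where c: "x = lam *\<^sub>R c" "blinfun_apply f c - \<alpha> * norm c > 1"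
    by (auto simp: dilate_def K_set_def)
  have "lam * 1 < lam * (blinfun_apply f c - \<alpha> * norm c)"
    using assms c(2) by (intro mult_strict_left_mono)
  then show "x \<in> {x. blinfun_apply f x - \<alpha> * norm x > lam}"
    using assms c(1) by (simp add: blinfun.scaleR_right algebra_simps)
next
  fix x
  assume "x \<in> {x. blinfun_apply f x - \<alpha> * norm x > lam}"
  then have "1 < (blinfun_apply f x - \<alpha> * norm x) / lam"
    using assms by simp
  then have "(1 / lam) *\<^sub>R x \<in> K_set f \<alpha>"
    using assms by (simp add: K_set_def blinfun.scaleR_right diff_divide_distrib)
  moreover have "x = lam *\<^sub>R (1 / lam) *\<^sub>R x"
    using assms by simp
  ultimately show "x \<in> dilate (K_set f \<alpha>) lam"
    unfolding dilate_def by (rule rev_image_eqI)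
qed

lemma mem_Eff_iff:
  "x \<in> Eff A C \<epsilon> \<longleftrightarrow> x \<in> A \<and> (\<forall>a\<in>A. x - a \<in> dilate C \<epsilon> \<longrightarrow> a = x)"
proof -
  have "a - x \<in> uminus ` dilate C \<epsilon> \<longleftrightarrow> x - a \<in> dilate C \<epsilon>" for a
  proof
    assume "a - x \<in> uminus ` dilate C \<epsilon>"
    then obtain d where "a - x = - d" "d \<in> dilate C \<epsilon>" by blast
    then show "x - a \<in> dilate C \<epsilon>" by (metis minus_diff_eq minus_minus)
  next
    assume "x - a \<in> dilate C \<epsilon>"
    then have "- (x - a) \<in> uminus ` dilate C \<epsilon>" by (rule imageI)
    then show "a - x \<in> uminus ` dilate C \<epsilon>" by simp
  qed
  then have "((\<lambda>a. a - x) ` A \<inter> uminus ` dilate C \<epsilon> \<subseteq> {0}) \<longleftrightarrow>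
      (\<forall>a\<in>A. x - a \<in> dilate C \<epsilon> \<longrightarrow> a - x = 0)"
    by blast
  then show ?thesis
    by (simp add: Eff_def)
qed

lemma Eff_antimono: "dilate C \<epsilon> \<subseteq> dilate D \<delta> \<Longrightarrow> Eff A D \<delta> \<subseteq> Eff A C \<epsilon>"
  unfolding mem_Eff_iff subset_iff by blast

text \<open>The exception a = x in \<open>mem_Eff_iff\<close> can be absorbed: the difference is
  then 0, where f - \<alpha> * norm vanishes and so stays below lam.\<close>

lemma mem_Eff_K_set_iff:
  assumes "lam > 0"
  shows "x \<in> Eff A (K_set f \<alpha>) lam \<longleftrightarrow>
    x \<in> A \<and> (\<forall>a\<in>A. blinfun_apply f (x - a) - \<alpha> * norm (x - a) \<le> lam)"
proof -
  have "blinfun_apply f (x - x) - \<alpha> * norm (x - x) \<le> lam"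
    using assms by simp
  then show ?thesis
    unfolding mem_Eff_iff dilate_K_set[OF assms] mem_Collect_eq by (metis not_less)
qed

theorem theorem5p5:
  fixes C A :: "'a::real_normed_vector set" and \<epsilon> lam :: real
  assumes "co_radiant C" and "dist_origin C > 0" and "\<epsilon> > 0" and "lam > 0"
  shows "(\<forall>f \<alpha>. (f, \<alpha>) \<in> aug_dual_sharp C lam \<epsilon> \<longrightarrow> Eff A (K_set f \<alpha>) lam \<subseteq> Eff A C \<epsilon>)
    \<and> (\<forall>f \<alpha> x0. (f, \<alpha>) \<in> aug_dual_star C lam \<epsilon> \<and> x0 \<in> Eff A (K_set f \<alpha>) lam
          \<longrightarrow> ((\<lambda>x. x0 + x) ` {x. p_fun f \<alpha> x < 0}) \<inter> A \<subseteq> Eff A C \<epsilon>)"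
proof (intro conjI allI impI)
  fix f \<alpha>
  assume "(f, \<alpha>) \<in> aug_dual_sharp C lam \<epsilon>"
  then have "dilate C \<epsilon> \<subseteq> dilate (K_set f \<alpha>) lam"
    using assms(4) by (auto simp: dilate_K_set aug_dual_sharp_def)
  then show "Eff A (K_set f \<alpha>) lam \<subseteq> Eff A C \<epsilon>"
    by (rule Eff_antimono)
next
  fix f \<alpha> x0
  assume "(f, \<alpha>) \<in> aug_dual_star C lam \<epsilon> \<and> x0 \<in> Eff A (K_set f \<alpha>) lam"
  then have \<alpha>: "\<alpha> > 0"
    and star: "\<And>y. y \<in> dilate C \<epsilon> \<Longrightarrow> blinfun_apply f y - \<alpha> * norm y \<ge> lam"
    and x0: "\<And>a. a \<in> A \<Longrightarrow> blinfun_apply f (x0 - a) - \<alpha> * norm (x0 - a) \<le> lam"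
    using assms(4) by (auto simp: aug_dual_star_def mem_Eff_K_set_iff)
  show "((\<lambda>x. x0 + x) ` {x. p_fun f \<alpha> x < 0}) \<inter> A \<subseteq> Eff A C \<epsilon>"
  proof
    fix x
    assume "x \<in> ((\<lambda>x. x0 + x) ` {x. p_fun f \<alpha> x < 0}) \<inter> A"
    then obtain u where u: "x = x0 + u" "p_fun f \<alpha> u < 0" and "x \<in> A"
      by auto
    \<comment> \<open>The contradiction covers a = x as well, since the bound \<open>x0\<close>
      holds for every point of A.\<close>
    have False if "a \<in> A" and y: "x - a \<in> dilate C \<epsilon>" for a
    proof -
      \<comment> \<open>Since x0 - a = (x - a) - u, the norm of u enters with a plus sign while f u
        is subtracted; together they form - p(u).\<close>
      have "norm (x0 - a) \<le> norm (x - a) + norm u"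
        using norm_triangle_ineq4[of "x - a" u] by (simp add: u(1))
      then have "\<alpha> * norm (x0 - a) \<le> \<alpha> * norm (x - a) + \<alpha> * norm u"
        using \<alpha> by (simp flip: distrib_left)
      moreover have "blinfun_apply f (x0 - a) = blinfun_apply f (x - a) - blinfun_apply f u"
        by (simp add: u(1) blinfun.diff_right blinfun.add_right)
      ultimately show False
        using star[OF y] x0[OF \<open>a \<in> A\<close>] u(2) by (simp add: p_fun_def)
    qed
    then show "x \<in> Eff A C \<epsilon>"
      using \<open>x \<in> A\<close> by (auto simp: mem_Eff_iff)
  qed
qed

end
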